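(* Let $\varphi:\mathbb{R}^n\to\mathbb{R}$ be abs-smooth with evaluation procedure $(f,c)$ having $s$ switching variables, let $\mathring{x}\in\mathbb{R}^n$, and let $\mathring{\sigma}=\operatorname{sign}(z[\mathring{x}])$. Assume that $(f,c)$ satisfies the linear independence kink qualification (LIKQ) at $\mathring{x}$. Then $$\partial_L\varphi(\mathring{x})=\bigcup_{\sigma\in\mathcal{D}(\mathring{\sigma})}\{\nabla\varphi_\sigma(\mathring{x})\}.$$
   Context: Evaluation procedures. Let $n,s\in\mathbb{N}$, $f\in C^2(\mathbb{R}^n\times\mathbb{R}^s\times\mathbb{R}^s;\mathbb{R})$ and $c\in C^2(\mathbb{R}^n\times\mathbb{R}^s\times\mathbb{R}^s;\mathbb{R}^s)$, with arguments denoted $(x,y,z)$, such that $\partial_y c(x,y,z)$ and $\partial_z c(x,y,z)$ are strictly lower triangular $s\times s$ matrices for all $(x,y,z)$. Then for every $x$ the switching equation $z=c(x,|z|,z)$ (with componentwise absolute value) has a unique solution, denoted $z[x]\in\mathbb{R}^s$. If $\varphi(x)=f(x,|z[x]|,z[x])$ for all $x\in\mathbb{R}^n$, then $(f,c)$ is called an evaluation procedure of $\varphi$ (with $s$ switching variables), and $\varphi$ is called abs-smooth. Smooth models. For $\xi\in[-1,1]^s$ and $\Xi=\operatorname{diag}(\xi)$, let $z_\xi[x]$ be the unique solution of $z_\xi=c(x,\Xi z_\xi,z_\xi)$, and set $\varphi_\xi(x)=f(x,\Xi z_\xi[x],z_\xi[x])$; then $\varphi_\xi\in C^2(\mathbb{R}^n)$.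 Signatures. $\operatorname{sign}$ acts componentwise with values in $\{-1,0,1\}$. For $\sigma,\mathring{\sigma}\in\{-1,0,1\}^s$, $\sigma\succeq\mathring{\sigma}$ means $\sigma_i\mathring{\sigma}_i\ge\mathring{\sigma}_i^2$ for all $i$, i.e. $\sigma_i=\mathring{\sigma}_i$ whenever $\mathring{\sigma}_i\neq0$. $\mathcal{D}(\mathring{\sigma})=\{\sigma\in\{-1,1\}^s\mid\sigma\succeq\mathring{\sigma}\}$. LIKQ. For fixed $\mathring{x}$, let $\mathring{z}=z[\mathring{x}]$, $\mathring{\sigma}=\operatorname{sign}(\mathring{z})$, $\mathring{\Sigma}=\operatorname{diag}(\mathring{\sigma})$, $\mathring{\alpha}=\{i\mid\mathring{\sigma}_i=0\}$, let $P_{\mathring{\alpha}}\in\mathbb{R}^{|\mathring{\alpha}|\times s}$ be the matrix with rows $e_i^T$, $i\in\mathring{\alpha}$, and let $Z=\partial_x c\in\mathbb{R}^{s\times n}$, $L=\partial_y c$, $M=\partial_z c\in\mathbb{R}^{s\times s}$ be the Jacobians of $c$ at $(\mathring{x},|\mathring{z}|,\mathring{z})$. The procedure $(f,c)$ satisfies LIKQ at $\mathring{x}$ if $P_{\mathring{\alpha}}(I_s-L\mathring{\Sigma}-M)^{-1}Z$ has full row rank $|\mathring{\alpha}|$. Limiting gradients. For locally Lipschitz $\varphi$, $\partial_L\varphi(\mathring{x})$ is the set of all $g=\lim_k\nabla\varphi(x_k)$ where $x_k\to\mathring{x}$ and $\varphi$ is differentiable at every $x_k$. *)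

theory Defs
  imports "HOL-Analysis.Analysis"
begin

definition C2 :: "('a::real_normed_vector \<Rightarrow> 'b::real_normed_vector) \<Rightarrow> bool" where
  "C2 f \<longleftrightarrow> (\<exists>(f' :: 'a \<Rightarrow> 'a \<Rightarrow>\<^sub>L 'b) (f'' :: 'a \<Rightarrow> 'a \<Rightarrow>\<^sub>L ('a \<Rightarrow>\<^sub>L 'b)).
     (\<forall>x. (f has_derivative blinfun_apply (f' x)) (at x)) \<and>
     (\<forall>x. (f' has_derivative blinfun_apply (f'' x)) (at x)) \<and>
     continuous_on UNIV f'')"

text \<open>The index type \<open>'s\<close> of the switching variables is linearly ordered, so that lower
  triangularity makes sense; being finite, it is order isomorphic to \<open>{1..CARD('s)}\<close>.\<close>

definition strictly_lower_triangular :: "real ^ 's::{finite,linorder} ^ 's::{finite,linorder} \<Rightarrow> bool" where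
  "strictly_lower_triangular A \<longleftrightarrow> (\<forall>i j. i \<le> j \<longrightarrow> A $ i $ j = 0)"

definition diag :: "real ^ 's \<Rightarrow> real ^ 's ^ 's" where
  "diag v = (\<chi> i j. if i = j then v $ i else 0)"

text \<open>Absolute value and sign are taken componentwise. For the sign this differs from the
  library's \<open>sgn\<close> on vectors, which is normalisation by the Euclidean norm.\<close>

definition vabs :: "real ^ 's \<Rightarrow> real ^ 's" where
  "vabs v = (\<chi> i. \<bar>v $ i\<bar>)"

definition vsign :: "real ^ 's \<Rightarrow> real ^ 's" where
  "vsign v = (\<chi> i. sgn (v $ i))"

text \<open>\<open>jac_x c (x, y, z)\<close>, \<open>jac_y c (x, y, z)\<close> and \<open>jac_z c (x, y, z)\<close> are the partial
  Jacobians of \<open>c\<close> at \<open>(x, y, z)\<close>.\<close>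

definition jac_x ::
  "((real ^ 'n) \<times> (real ^ 's) \<times> (real ^ 's) \<Rightarrow> real ^ 's) \<Rightarrow> (real ^ 'n) \<times> (real ^ 's) \<times> (real ^ 's) \<Rightarrow> real ^ 'n ^ 's" where
  "jac_x c = (\<lambda>(x, y, z). jacobian (\<lambda>u. c (u, y, z)) (at x))"

definition jac_y ::
  "((real ^ 'n) \<times> (real ^ 's) \<times> (real ^ 's) \<Rightarrow> real ^ 's) \<Rightarrow> (real ^ 'n) \<times> (real ^ 's) \<times> (real ^ 's) \<Rightarrow> real ^ 's ^ 's" where
  "jac_y c = (\<lambda>(x, y, z). jacobian (\<lambda>u. c (x, u, z)) (at y))"

definition jac_z ::
  "((real ^ 'n) \<times> (real ^ 's) \<times> (real ^ 's) \<Rightarrow> real ^ 's) \<Rightarrow> (real ^ 'n) \<times> (real ^ 's) \<times> (real ^ 's) \<Rightarrow> real ^ 's ^ 's" where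
  "jac_z c = (\<lambda>(x, y, z). jacobian (\<lambda>u. c (x, y, u)) (at z))"

text \<open>Both descriptions below single out a unique vector whenever \<open>c\<close> is continuously
  differentiable with strictly lower triangular partial Jacobians in \<open>y\<close> and \<open>z\<close>: the equation
  is then solved by forward substitution.\<close>

definition switching ::
  "((real ^ 'n) \<times> (real ^ 's) \<times> (real ^ 's) \<Rightarrow> real ^ 's) \<Rightarrow> real ^ 'n \<Rightarrow> real ^ 's" where
  "switching c x = (THE z. z = c (x, vabs z, z))"

definition smooth_switching ::
  "((real ^ 'n) \<times> (real ^ 's) \<times> (real ^ 's) \<Rightarrow> real ^ 's) \<Rightarrow> real ^ 's \<Rightarrow> real ^ 'n \<Rightarrow> real ^ 's" where
  "smooth_switching c \<xi> x = (THE z. z = c (x, diag \<xi> *v z, z))"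

definition smooth_model ::
  "((real ^ 'n) \<times> (real ^ 's) \<times> (real ^ 's) \<Rightarrow> real) \<Rightarrow> ((real ^ 'n) \<times> (real ^ 's) \<times> (real ^ 's) \<Rightarrow> real ^ 's) \<Rightarrow>
    real ^ 's \<Rightarrow> real ^ 'n \<Rightarrow> real" where
  "smooth_model f c \<xi> x =
     f (x, diag \<xi> *v smooth_switching c \<xi> x, smooth_switching c \<xi> x)"

definition evaluation_procedure ::
  "((real ^ 'n) \<times> (real ^ 's::{finite,linorder}) \<times> (real ^ 's::{finite,linorder}) \<Rightarrow> real) \<Rightarrow>
    ((real ^ 'n) \<times> (real ^ 's::{finite,linorder}) \<times> (real ^ 's::{finite,linorder}) \<Rightarrow> real ^ 's::{finite,linorder}) \<Rightarrow>
    (real ^ 'n \<Rightarrow> real) \<Rightarrow> bool" where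
  "evaluation_procedure f c \<phi> \<longleftrightarrow>
     C2 f \<and> C2 c \<and>
     (\<forall>p. strictly_lower_triangular (jac_y c p) \<and> strictly_lower_triangular (jac_z c p)) \<and>
     (\<forall>x. \<phi> x = f (x, vabs (switching c x), switching c x))"

text \<open>Signatures are vectors with entries in \<open>{-1, 0, 1}\<close>.\<close>

definition sig_succeq :: "real ^ 's \<Rightarrow> real ^ 's \<Rightarrow> bool" where
  "sig_succeq \<sigma> \<tau> \<longleftrightarrow> (\<forall>i. \<sigma> $ i * \<tau> $ i \<ge> (\<tau> $ i)\<^sup>2)"

definition definite_sigs :: "real ^ 's \<Rightarrow> (real ^ 's) set" where
  "definite_sigs \<tau> = {\<sigma>. (\<forall>i. \<sigma> $ i \<in> {-1, 1}) \<and> sig_succeq \<sigma> \<tau>}"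

text \<open>\<open>row_selector \<alpha>\<close> is the matrix with rows \<open>e\<^sub>i\<^sup>T\<close>, \<open>i \<in> \<alpha>\<close>, padded by a zero row for each
  \<open>i \<notin> \<alpha>\<close>, because the number of rows of a matrix is fixed by its type. In a product
  \<open>row_selector \<alpha> ** A\<close> the padding only adds zero rows and leaves the rank unchanged.\<close>

definition row_selector :: "'s set \<Rightarrow> real ^ 's ^ 's" where
  "row_selector \<alpha> = (\<chi> i j. if i \<in> \<alpha> \<and> i = j then 1 else 0)"

definition LIKQ ::
  "((real ^ 'n) \<times> (real ^ 's) \<times> (real ^ 's) \<Rightarrow> real ^ 's) \<Rightarrow> real ^ 'n \<Rightarrow> bool" where
  "LIKQ c x \<longleftrightarrow>
     (let z = switching c x;
          \<sigma> = vsign z;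
          \<alpha> = {i. \<sigma> $ i = 0};
          Z = jac_x c (x, vabs z, z);
          L = jac_y c (x, vabs z, z);
          M = jac_z c (x, vabs z, z)
      in rank (row_selector \<alpha> ** matrix_inv (mat 1 - L ** diag \<sigma> - M) ** Z) = card \<alpha>)"

definition gradient :: "('a::real_inner \<Rightarrow> real) \<Rightarrow> 'a \<Rightarrow> 'a" where
  "gradient f x = (THE g. GDERIV f x :> g)"

definition limiting_gradients :: "('a::real_inner \<Rightarrow> real) \<Rightarrow> 'a \<Rightarrow> 'a set" where
  "limiting_gradients f x =
     {g. \<exists>X :: nat \<Rightarrow> 'a. X \<longlonglongrightarrow> x \<and> (\<forall>k. f differentiable at (X k)) \<and>
           (\<lambda>k. gradient f (X k)) \<longlonglongrightarrow> g}"

end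

theory Submission
  imports Defs
begin

text \<open>For definite \<open>\<sigma>\<close>, the function \<open>\<phi>\<close> agrees with the smooth model of \<open>\<sigma>\<close> wherever the smooth
  switching vector has the signs \<open>\<sigma>\<close>. LIKQ provides, for each \<open>\<sigma>\<close> compatible with the signature at
  \<open>x0\<close>, a direction along which all vanishing switching variables acquire the signs \<open>\<sigma>\<close> to first
  order. Approaching \<open>x0\<close> along it shows that the gradient of that model is a limiting gradient.
  Conversely, along a sequence of points of differentiability pass to a subsequence on which one
  definite \<open>\<sigma>\<close> fits all switching vectors. By continuity the same direction is still good near
  \<open>x0\<close>, so \<open>\<phi>\<close> and the model agree on an open cone of directions at these points and have equal
  gradients there.\<close>

section \<open>Calculus of continuously differentiable maps\<close>

text \<open>Since the domain is finite-dimensional, pointwise continuity of the derivative amounts to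
  continuity in operator norm.\<close>

definition C1 :: "('a::euclidean_space \<Rightarrow> 'b::real_normed_vector) \<Rightarrow> bool" where
  "C1 f \<longleftrightarrow> (\<exists>D. (\<forall>x. (f has_derivative D x) (at x)) \<and> (\<forall>v. continuous_on UNIV (\<lambda>x. D x v)))"

lemma C1_bounded_linear: "bounded_linear f \<Longrightarrow> C1 f"
  unfolding C1_def
  by (rule exI[of _ "\<lambda>_. f"]) (simp add: bounded_linear_imp_has_derivative)

lemma C1_ident: "C1 (\<lambda>x. x)"
  by (rule C1_bounded_linear) (rule bounded_linear_ident)

lemma C1_const: "C1 (\<lambda>_. k)"
  unfolding C1_def by (rule exI[of _ "\<lambda>_ _. 0"]) simp

lemma C1_Pair:
  assumes "C1 f" "C1 g"
  shows "C1 (\<lambda>x. (f x, g x))"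
proof -
  obtain F G where "\<forall>x. (f has_derivative F x) (at x)" "\<forall>v. continuous_on UNIV (\<lambda>x. F x v)"
    "\<forall>x. (g has_derivative G x) (at x)" "\<forall>v. continuous_on UNIV (\<lambda>x. G x v)"
    using assms unfolding C1_def by blast
  then show ?thesis
    unfolding C1_def
    by (intro exI[of _ "\<lambda>x v. (F x v, G x v)"]) (auto intro!: has_derivative_Pair continuous_on_Pair)
qed

lemma C1_compose:
  fixes f :: "'a::euclidean_space \<Rightarrow> 'b::euclidean_space"
  assumes "C1 g" "C1 f"
  shows "C1 (\<lambda>x. g (f x))"
proof -
  obtain F G where F: "\<And>x. (f has_derivative F x) (at x)" "\<And>v. continuous_on UNIV (\<lambda>x. F x v)"
    and G: "\<And>x. (g has_derivative G x) (at x)" "\<And>v. continuous_on UNIV (\<lambda>x. G x v)"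
    using assms unfolding C1_def by blast
  have "continuous_on UNIV f"
    using F(1) by (rule has_derivative_continuous_on)
  then have *: "continuous_on UNIV (\<lambda>x. G (f x) v)" for v
    using continuous_on_compose2[OF G(2)] by blast
  \<comment> \<open>In \<open>G (f x) (F x v)\<close> the direction moves with \<open>x\<close>,
    while continuity of \<open>G\<close> is known only for fixed directions. Expanding
    \<open>F x v\<close> in the basis leaves fixed directions with continuous coefficients.\<close>
  have "G (f x) (F x v) = (\<Sum>b\<in>Basis. (F x v \<bullet> b) *\<^sub>R G (f x) b)" for x v
  proof -
    interpret linear "G (f x)" using G(1) has_derivative_linear by blast
    have "G (f x) (\<Sum>b\<in>Basis. (F x v \<bullet> b) *\<^sub>R b) = (\<Sum>b\<in>Basis. (F x v \<bullet> b) *\<^sub>R G (f x) b)"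
      by (simp add: sum scale)
    then show ?thesis by (simp add: euclidean_representation)
  qed
  then have "continuous_on UNIV (\<lambda>x. G (f x) (F x v))" for v
    by (auto intro!: continuous_intros * F(2))
  moreover have "((\<lambda>x. g (f x)) has_derivative (\<lambda>v. G (f x) (F x v))) (at x)" for x
    using has_derivative_compose[OF F(1) G(1)] .
  ultimately show ?thesis
    unfolding C1_def by (intro exI[of _ "\<lambda>x v. G (f x) (F x v)"]) simp
qed

lemma C2_imp_C1:
  assumes "C2 f"
  shows "C1 f"
proof -
  obtain f' f'' where f': "\<And>x. (f has_derivative blinfun_apply (f' x)) (at x)"
    and f'': "\<And>x. (f' has_derivative blinfun_apply (f'' x)) (at x)"
    using assms unfolding C2_def by blast
  have "continuous_on UNIV f'"
    using f'' by (intro has_derivative_continuous_on)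
  then have "continuous_on UNIV (\<lambda>x. blinfun_apply (f' x) v)" for v
    by (intro continuous_intros)
  with f' show ?thesis
    unfolding C1_def by (intro exI[of _ "\<lambda>x. blinfun_apply (f' x)"]) simp
qed

section \<open>First-order behaviour along rays\<close>

text \<open>The one-sided difference quotients of \<open>g - h\<close> vanish along every direction
  in \<open>U\<close>, so the linear map \<open>g' - h'\<close> is zero on a nonempty open set and
  hence everywhere.\<close>

lemma has_derivative_eqI_directions:
  fixes g h :: "'a::real_normed_vector \<Rightarrow> real"
  assumes g: "(g has_derivative g') (at x)" and h: "(h has_derivative h') (at x)"
    and U: "open U" "d \<in> U"
    and eq: "\<And>e. e \<in> U \<Longrightarrow> \<forall>\<^sub>F t in at_right 0. g (x + t *\<^sub>R e) = h (x + t *\<^sub>R e)"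
    and eqx: "g x = h x"
  shows "g' = h'"
proof -
  define u where "u = (\<lambda>y. g y - h y)"
  have u: "(u has_derivative (\<lambda>v. g' v - h' v)) (at x)"
    unfolding u_def by (intro derivative_intros g h)
  interpret lin: linear "\<lambda>v. g' v - h' v"
    using u has_derivative_linear by blast
  have zero: "g' e - h' e = 0" if "e \<in> U" for e
  proof -
    have "((\<lambda>t. u (x + t *\<^sub>R e)) has_derivative (\<lambda>t. g' (t *\<^sub>R e) - h' (t *\<^sub>R e))) (at 0)"
      by (rule has_derivative_compose[of "\<lambda>t. x + t *\<^sub>R e" "\<lambda>t. t *\<^sub>R e" 0 UNIV u])
         (use u in \<open>auto intro!: derivative_eq_intros\<close>)
    then have "((\<lambda>t. u (x + t *\<^sub>R e)) has_field_derivative (g' e - h' e)) (at 0)"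
      unfolding has_field_derivative_def by (simp add: lin.scale mult_commute_abs)
    then have "((\<lambda>t. (u (x + t *\<^sub>R e) - u x) / t) \<longlongrightarrow> g' e - h' e) (at_right 0)"
      unfolding DERIV_def by (simp add: filterlim_at_split)
    moreover have "\<forall>\<^sub>F t in at_right 0. (u (x + t *\<^sub>R e) - u x) / t = 0"
      using eq[OF that] by eventually_elim (simp add: u_def eqx)
    ultimately have "((\<lambda>t::real. 0::real) \<longlongrightarrow> g' e - h' e) (at_right 0)"
      by (rule Lim_transform_eventually)
    then show ?thesis
      using tendsto_unique[OF _ _ tendsto_const] trivial_limit_at_right_real by metis
  qed
  have "g' v - h' v = 0" for v
  proof -
    \<comment> \<open>Any \<open>v\<close> is a multiple of the difference between two elements of
      \<open>U\<close>, namely \<open>d\<close> and a nearby point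
      \<open>d + t *\<^sub>R v\<close>.\<close>
    have "((\<lambda>t. d + t *\<^sub>R v) \<longlongrightarrow> d + 0 *\<^sub>R v) (at_right (0::real))"
      by (intro tendsto_intros)
    then have "\<forall>\<^sub>F t in at_right (0::real). d + t *\<^sub>R v \<in> U"
      using U topological_tendstoD by fastforce
    then have "\<forall>\<^sub>F t in at_right (0::real). d + t *\<^sub>R v \<in> U \<and> t > 0"
      using eventually_at_right_less by (rule eventually_conj)
    then obtain t :: real where t: "d + t *\<^sub>R v \<in> U" "t > 0"
      using eventually_happens trivial_limit_at_right_real by blast
    have "g' (d + t *\<^sub>R v) - h' (d + t *\<^sub>R v) = (g' d - h' d) + t *\<^sub>R (g' v - h' v)"
      by (simp add: lin.add lin.scale)
    with zero[OF t(1)] zero[OF U(2)] t(2) show ?thesis by simp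
  qed
  then show ?thesis by auto
qed

text \<open>A positive value persists by continuity; from the value 0 a positive directional
  derivative makes the function increase to the right.\<close>

lemma has_derivative_eventually_pos:
  fixes g :: "'a::real_normed_vector \<Rightarrow> real"
  assumes g: "(g has_derivative g') (at x)" and "0 \<le> g x" "0 < g x \<or> 0 < g' e"
  shows "\<forall>\<^sub>F t in at_right 0. 0 < g (x + t *\<^sub>R e)"
proof (cases "0 < g x")
  case True
  have "isCont g (x + 0 *\<^sub>R e)" using g has_derivative_continuous by auto
  then have "((\<lambda>t. g (x + t *\<^sub>R e)) \<longlongrightarrow> g (x + 0 *\<^sub>R e)) (at_right (0::real))"
    by (rule isCont_tendsto_compose) (intro tendsto_intros)
  then show ?thesis using order_tendstoD(1) True by fastforce
next
  case False
  interpret linear g' using g has_derivative_linear by blast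
  have "((\<lambda>t. g (x + t *\<^sub>R e)) has_derivative (\<lambda>t. g' (t *\<^sub>R e))) (at 0)"
    by (rule has_derivative_compose[of "\<lambda>t. x + t *\<^sub>R e" "\<lambda>t. t *\<^sub>R e" 0 UNIV g])
       (use g in \<open>auto intro!: derivative_eq_intros\<close>)
  then have "((\<lambda>t. g (x + t *\<^sub>R e)) has_field_derivative g' e) (at 0)"
    unfolding has_field_derivative_def by (simp add: scale mult_commute_abs)
  then obtain r where "0 < r" "\<And>h. 0 < h \<Longrightarrow> h < r \<Longrightarrow> g x < g (x + h *\<^sub>R e)"
    using DERIV_pos_inc_right[of "\<lambda>t. g (x + t *\<^sub>R e)" "g' e" 0] False assms(3) by auto
  then show ?thesis
    using assms(2) unfolding eventually_at_right_field by fastforce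
qed

section \<open>Gradients in coordinates\<close>

text \<open>This replaces the description by \<open>THE\<close> with a formula in the derivative:
  equal derivatives give equal gradients, and continuity of the gradient becomes continuity of a
  finite sum.\<close>

lemma gradient_eq_sum_Basis:
  fixes f :: "'a::euclidean_space \<Rightarrow> real"
  assumes "(f has_derivative D) (at x)"
  shows "gradient f x = (\<Sum>b\<in>Basis. D b *\<^sub>R b)"
proof -
  interpret linear D using assms has_derivative_linear by blast
  let ?g = "\<Sum>b\<in>Basis. D b *\<^sub>R b"
  have "D h = h \<bullet> ?g" for h
  proof -
    have "D (\<Sum>b\<in>Basis. (h \<bullet> b) *\<^sub>R b) = (\<Sum>b\<in>Basis. (h \<bullet> b) * D b)"
      by (simp add: sum scale)
    then show ?thesis
      by (simp add: euclidean_representation inner_sum_right mult.commute)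
  qed
  with assms have D: "GDERIV f x :> ?g"
    unfolding gderiv_def by (metis (no_types, lifting) has_derivative_subst ext)
  moreover have "g = ?g" if "GDERIV f x :> g" for g
  proof -
    have "(\<lambda>h. h \<bullet> g) = (\<lambda>h. h \<bullet> ?g)"
      using that D has_derivative_unique unfolding gderiv_def by blast
    then show ?thesis by (metis inner_commute vector_eq_ldot)
  qed
  ultimately show ?thesis
    unfolding gradient_def by (intro the_equality)
qed

lemma C1_continuous_gradient:
  fixes f :: "'a::euclidean_space \<Rightarrow> real"
  assumes "C1 f"
  shows "continuous_on UNIV (gradient f)"
proof -
  obtain D where D: "\<And>x. (f has_derivative D x) (at x)" "\<And>v. continuous_on UNIV (\<lambda>x. D x v)"
    using assms unfolding C1_def by blast
  have "gradient f = (\<lambda>x. \<Sum>b\<in>Basis. D x b *\<^sub>R b)"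
    using gradient_eq_sum_Basis[OF D(1)] by blast
  then show ?thesis by (auto intro!: continuous_intros D(2))
qed

section \<open>Forward substitution and strictly triangular Jacobians\<close>

text \<open>Forward substitution: each application of such an \<open>H\<close> fixes one more component.\<close>

definition forward :: "('a ^ 's::{finite,linorder} \<Rightarrow> 'a ^ 's::{finite,linorder}) \<Rightarrow> bool" where
  "forward H \<longleftrightarrow> (\<forall>z w i. (\<forall>j<i. z $ j = w $ j) \<longrightarrow> H z $ i = H w $ i)"

text \<open>Two fixed points agree component by component. The induction runs on the number of
  smaller indices, which serves as the position of \<open>i\<close> in the finite linear
  order.\<close>

lemma forward_unique:
  fixes z w :: "'a ^ 's::{finite,linorder}"
  assumes "forward H" "z = H z" "w = H w"
  shows "z = w"
proof -
  have "z $ i = w $ i" for i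
  proof (induction i rule: measure_induct_rule[of "\<lambda>i. card {..<i}"])
    case (less i)
    have "card {..<j} < card {..<i}" if "j < i" for j
      by (rule psubset_card_mono) (use that in auto)
    with less have "\<forall>j<i. z $ j = w $ j" by blast
    then show ?case using assms unfolding forward_def by metis
  qed
  then show ?thesis by (simp add: vec_eq_iff)
qed

lemma forward_fixpoint:
  fixes H :: "'a ^ 's::{finite,linorder} \<Rightarrow> 'a ^ 's::{finite,linorder}"
  assumes "forward H"
  shows "(H ^^ CARD('s)) a = H ((H ^^ CARD('s)) a)"
proof -
  \<comment> \<open>Here \<open>card {..i}\<close> is the position of \<open>i\<close> counted from
    1: after \<open>m\<close> steps the first \<open>m\<close> components are final, whatever the
    start \<open>a\<close>. For \<open>m = 0\<close> the claim is vacuous.\<close>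
  have "\<forall>i. card {..i} \<le> m \<longrightarrow> (H ^^ Suc m) a $ i = (H ^^ m) a $ i" for m
  proof (induction m)
    case 0
    have "card {..i::'s} > 0" for i by (auto simp: card_gt_0_iff)
    then show ?case by auto
  next
    case (Suc m)
    show ?case
    proof (intro allI impI)
      fix i :: 's assume i: "card {..i} \<le> Suc m"
      have "(H ^^ Suc m) a $ j = (H ^^ m) a $ j" if "j < i" for j
      proof -
        have "card {..j} < card {..i}"
          by (rule psubset_card_mono) (use that in auto)
        with i Suc show ?thesis by auto
      qed
      then show "(H ^^ Suc (Suc m)) a $ i = (H ^^ Suc m) a $ i"
        using assms unfolding forward_def by simp
    qed
  qed
  moreover have "card {..i::'s} \<le> CARD('s)" for i by (rule card_mono) auto
  ultimately show ?thesis by (simp add: vec_eq_iff)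
qed

lemma forward_THE_eqI:
  assumes "forward H" "z = H z"
  shows "(THE z. z = H z) = z"
  by (rule the_equality) (use assms in \<open>simp_all add: forward_unique[OF assms(1) _ assms(2)]\<close>)

lemma strictly_lower_triangular_forward:
  fixes A :: "real ^ 's::{finite,linorder} ^ 's::{finite,linorder}"
  assumes "strictly_lower_triangular A"
  shows "forward (\<lambda>z. A *v z)"
  unfolding forward_def matrix_vector_mult_def
proof (intro allI impI)
  fix z w :: "real ^ 's::{finite,linorder}" and i assume *: "\<forall>j<i. z $ j = w $ j"
  have "A $ i $ j * z $ j = A $ i $ j * w $ j" for j
    using assms * unfolding strictly_lower_triangular_def by (cases "i \<le> j") auto
  then show "(\<chi> i. \<Sum>j\<in>UNIV. A $ i $ j * z $ j) $ i = (\<chi> i. \<Sum>j\<in>UNIV. A $ i $ j * w $ j) $ i"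
    by (simp only: vec_lambda_beta cong: sum.cong)
qed

text \<open>If \<open>a\<close> and \<open>b\<close> agree below \<open>i\<close>, then row
  \<open>i\<close> of the Jacobian annihilates \<open>b - a\<close>, so component \<open>i\<close>
  of \<open>g\<close> is constant on the segment from \<open>a\<close> to \<open>b\<close>.\<close>

lemma strictly_lower_jacobian_forward:
  fixes g :: "real ^ 's::{finite,linorder} \<Rightarrow> real ^ 's::{finite,linorder}"
  assumes diff: "\<And>u. g differentiable (at u)"
    and lower: "\<And>u. strictly_lower_triangular (jacobian g (at u))"
  shows "forward g"
  unfolding forward_def
proof (intro allI impI)
  fix a b :: "real ^ 's::{finite,linorder}" and i assume ab: "\<forall>j<i. a $ j = b $ j"
  have "((\<lambda>t. g (a + t *\<^sub>R (b - a)) $ i) has_real_derivative 0) (at t)" for t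
  proof -
    let ?J = "jacobian g (at (a + t *\<^sub>R (b - a)))"
    have "(?J *v (b - a)) $ i = (?J *v 0) $ i"
      using strictly_lower_triangular_forward[OF lower] ab unfolding forward_def
      by (metis (no_types, lifting) eq_iff_diff_eq_0 vector_minus_component zero_index)
    then have J: "(?J *v (b - a)) $ i = 0" by simp
    have "((\<lambda>t. g (a + t *\<^sub>R (b - a))) has_derivative (\<lambda>s. ?J *v (s *\<^sub>R (b - a)))) (at t)"
      by (rule has_derivative_compose[of _ "\<lambda>s. s *\<^sub>R (b - a)" t UNIV g])
         (use diff jacobian_works in \<open>auto intro!: derivative_eq_intros\<close>)
    then have "((\<lambda>t. g (a + t *\<^sub>R (b - a)) $ i) has_derivative (\<lambda>s. (?J *v (s *\<^sub>R (b - a))) $ i)) (at t)"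
      by (rule bounded_linear.has_derivative[OF bounded_linear_vec_nth])
    then show ?thesis
      unfolding has_field_derivative_def by (simp add: matrix_vector_mult_scaleR J lambda_zero)
  qed
  then have "g (a + 0 *\<^sub>R (b - a)) $ i = g (a + 1 *\<^sub>R (b - a)) $ i"
    by (intro DERIV_isconst_all[of "\<lambda>t. g (a + t *\<^sub>R (b - a)) $ i" 0 1] allI)
  then show "g a $ i = g b $ i" by simp
qed

section \<open>Diagonal matrices and row selection\<close>

lemma diag_mult_nth [simp]: "(diag \<xi> *v z) $ i = \<xi> $ i * z $ i"
  by (simp add: diag_def matrix_vector_mult_def if_distrib[of "\<lambda>a. a * _"] cong: if_cong)

lemma row_selector_mult_nth [simp]: "(row_selector \<alpha> *v z) $ i = (if i \<in> \<alpha> then z $ i else 0)"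
proof -
  have "row_selector \<alpha> $ i $ j * z $ j = (if i = j then (if i \<in> \<alpha> then z $ i else 0) else 0)" for j
    by (auto simp: row_selector_def)
  then show ?thesis by (simp add: matrix_vector_mult_def)
qed

text \<open>The range lies in the coordinate subspace of vectors supported on \<alpha>, whose
  dimension is \<open>card \<alpha>\<close>; equality of dimensions makes every prescription on
  \<alpha> attainable.\<close>

lemma row_selector_full_rank_surj:
  fixes A :: "real ^ 'n ^ 's"
  assumes "rank (row_selector \<alpha> ** A) = card \<alpha>"
  obtains d where "\<And>i. i \<in> \<alpha> \<Longrightarrow> (A *v d) $ i = v $ i"
proof -
  let ?S = "{w :: real ^ 's. \<forall>i. i \<notin> \<alpha> \<longrightarrow> w $ i = 0}"
  let ?R = "range (\<lambda>d. (row_selector \<alpha> ** A) *v d)"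
  have "?R \<subseteq> ?S"
    by (auto simp flip: matrix_vector_mul_assoc)
  moreover have "subspace ?R"
    by (intro linear_subspace_image) auto
  moreover have "subspace ?S"
    by (auto simp: subspace_def)
  moreover have "dim ?S \<le> dim ?R"
    using assms dim_substandard_cart[of \<alpha>, where ?'a = real] by (simp add: rank_dim_range dim_vec_eq)
  ultimately have "?R = ?S"
    using subspace_dim_equal by blast
  moreover have "row_selector \<alpha> *v v \<in> ?S" by simp
  ultimately obtain d where d: "row_selector \<alpha> *v v = (row_selector \<alpha> ** A) *v d"
    by blast
  have "(A *v d) $ i = v $ i" if "i \<in> \<alpha>" for i
    using arg_cong[OF d, of "\<lambda>w. w $ i"] that by (simp flip: matrix_vector_mul_assoc)
  then show thesis by (rule that)
qed

section \<open>Solvability and smoothness of the switching equations\<close>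

locale switching_system =
  fixes c :: "(real ^ 'n) \<times> (real ^ 's::{finite,linorder}) \<times> (real ^ 's::{finite,linorder}) \<Rightarrow> real ^ 's::{finite,linorder}"
  assumes C1: "C1 c"
    and lower_y: "\<And>p. strictly_lower_triangular (jac_y c p)"
    and lower_z: "\<And>p. strictly_lower_triangular (jac_z c p)"
begin

lemma has_partial_derivatives:
  assumes D: "(c has_derivative D) (at (x, y, z))"
  shows "((\<lambda>u. c (u, y, z)) has_derivative (\<lambda>d. D (d, 0, 0))) (at x)"
    and "((\<lambda>u. c (x, u, z)) has_derivative (\<lambda>e. D (0, e, 0))) (at y)"
    and "((\<lambda>u. c (x, y, u)) has_derivative (\<lambda>h. D (0, 0, h))) (at z)"
proof -
  show "((\<lambda>u. c (u, y, z)) has_derivative (\<lambda>d. D (d, 0, 0))) (at x)"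
    by (rule has_derivative_compose[where f = "\<lambda>u. (u, y, z)" and f' = "\<lambda>d. (d, 0, 0)" and g = c and g' = D])
       (intro has_derivative_Pair has_derivative_ident has_derivative_const, rule D)
  show "((\<lambda>u. c (x, u, z)) has_derivative (\<lambda>e. D (0, e, 0))) (at y)"
    by (rule has_derivative_compose[where f = "\<lambda>u. (x, u, z)" and f' = "\<lambda>d. (0, d, 0)" and g = c and g' = D])
       (intro has_derivative_Pair has_derivative_ident has_derivative_const, rule D)
  show "((\<lambda>u. c (x, y, u)) has_derivative (\<lambda>h. D (0, 0, h))) (at z)"
    by (rule has_derivative_compose[where f = "\<lambda>u. (x, y, u)" and f' = "\<lambda>d. (0, 0, d)" and g = c and g' = D])
       (intro has_derivative_Pair has_derivative_ident has_derivative_const, rule D)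
qed

lemma derivative_eq_jacobians:
  assumes D: "(c has_derivative D) (at p)"
  shows "D (d, e, h) = jac_x c p *v d + jac_y c p *v e + jac_z c p *v h"
proof -
  obtain x y z where p: "p = (x, y, z)" by (cases p)
  interpret linear D using D has_derivative_linear by blast
  have works: "g' v = jacobian g (at u) *v v"
    if "(g has_derivative g') (at u)" for g :: "real ^ 'k \<Rightarrow> real ^ 's::{finite,linorder}" and g' u v
  proof -
    have "(g has_derivative (\<lambda>h. jacobian g (at u) *v h)) (at u)"
      using that jacobian_works differentiableI by blast
    with that show ?thesis using has_derivative_unique by metis
  qed
  have "D (d, e, h) = D (d, 0, 0) + D (0, e, 0) + D (0, 0, h)"
    by (simp flip: add)
  then show ?thesis
    using has_partial_derivatives[OF D[unfolded p], THEN works]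
    by (simp add: p jac_x_def jac_y_def jac_z_def)
qed

text \<open>Only the arguments below \<open>i\<close> matter for component \<open>i\<close>: first
  \<open>y\<close> is exchanged, then \<open>z\<close>, each covered by its own triangular partial
  Jacobian.\<close>

lemma component_eq:
  assumes "\<forall>j<i. y $ j = y' $ j" "\<forall>j<i. z $ j = z' $ j"
  shows "c (x, y, z) $ i = c (x, y', z') $ i"
proof -
  obtain D where D: "\<And>p. (c has_derivative D p) (at p)"
    using C1 unfolding C1_def by blast
  have "forward (\<lambda>u. c (x, u, z))"
    using has_partial_derivatives(2)[OF D] lower_y[of "(x, _, z)"]
    by (intro strictly_lower_jacobian_forward) (auto simp: jac_y_def intro: differentiableI)
  moreover have "forward (\<lambda>u. c (x, y', u))"
    using has_partial_derivatives(3)[OF D] lower_z[of "(x, y', _)"]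
    by (intro strictly_lower_jacobian_forward) (auto simp: jac_z_def intro: differentiableI)
  ultimately have "c (x, y, z) $ i = c (x, y', z) $ i" "c (x, y', z) $ i = c (x, y', z') $ i"
    using assms unfolding forward_def by blast+
  then show ?thesis by simp
qed

lemma forward_smooth: "forward (\<lambda>z. c (x, diag \<xi> *v z, z))"
  unfolding forward_def by (auto intro!: component_eq)

lemma forward_abs: "forward (\<lambda>z. c (x, vabs z, z))"
  unfolding forward_def by (auto intro!: component_eq simp: vabs_def)

lemma smooth_switching_eqI: "z = c (x, diag \<xi> *v z, z) \<Longrightarrow> smooth_switching c \<xi> x = z"
  unfolding smooth_switching_def by (rule forward_THE_eqI[OF forward_smooth])

lemma smooth_switching_eq_iterate:
  "smooth_switching c \<xi> x = ((\<lambda>z. c (x, diag \<xi> *v z, z)) ^^ CARD('s)) 0"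
  by (rule smooth_switching_eqI, rule forward_fixpoint[OF forward_smooth])

lemma smooth_switching_fixpoint:
  "smooth_switching c \<xi> x = c (x, diag \<xi> *v smooth_switching c \<xi> x, smooth_switching c \<xi> x)"
  unfolding smooth_switching_eq_iterate by (rule forward_fixpoint[OF forward_smooth])

lemma switching_eqI: "z = c (x, vabs z, z) \<Longrightarrow> switching c x = z"
  unfolding switching_def by (rule forward_THE_eqI[OF forward_abs])

lemma switching_fixpoint: "switching c x = c (x, vabs (switching c x), switching c x)"
proof -
  let ?z = "((\<lambda>z. c (x, vabs z, z)) ^^ CARD('s)) 0"
  have "?z = c (x, vabs ?z, ?z)" by (rule forward_fixpoint[OF forward_abs])
  then show ?thesis unfolding switching_eqI[OF \<open>?z = _\<close>] .
qed

text \<open>Forward substitution reaches the solution after \<open>CARD('s)\<close> steps, each of which is a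
  composition of \<open>C1\<close> maps; no implicit function theorem is needed.\<close>

lemma C1_smooth_switching: "C1 (smooth_switching c \<xi>)"
proof -
  have "C1 (\<lambda>x. ((\<lambda>z. c (x, diag \<xi> *v z, z)) ^^ m) 0)" for m
  proof (induction m)
    case 0
    show ?case by (simp add: C1_const)
  next
    case (Suc m)
    have "C1 (\<lambda>x. diag \<xi> *v ((\<lambda>z. c (x, diag \<xi> *v z, z)) ^^ m) 0)"
      by (rule C1_compose[OF C1_bounded_linear Suc]) simp
    then show ?case
      unfolding funpow.simps o_apply by (intro C1_compose[OF C1] C1_Pair Suc C1_ident)
  qed
  then show ?thesis by (simp add: smooth_switching_eq_iterate[abs_def])
qed

lemma C1_smooth_model:
  assumes "C1 f"
  shows "C1 (smooth_model f c \<xi>)"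
proof -
  have "C1 (\<lambda>x. diag \<xi> *v smooth_switching c \<xi> x)"
    by (rule C1_compose[OF C1_bounded_linear C1_smooth_switching]) simp
  then show ?thesis
    unfolding smooth_model_def[abs_def]
    by (intro C1_compose[OF assms] C1_Pair C1_smooth_switching C1_ident)
qed

section \<open>The linearized switching equation\<close>

text \<open>Chain rule applied to both sides of the smooth switching equation.\<close>

lemma smooth_switching_derivative_fixpoint:
  fixes \<xi> x
  defines "p \<equiv> (x, diag \<xi> *v smooth_switching c \<xi> x, smooth_switching c \<xi> x)"
  assumes W: "(smooth_switching c \<xi> has_derivative W) (at x)"
  shows "W d = jac_y c p *v (diag \<xi> *v W d) + jac_z c p *v W d + jac_x c p *v d"
proof -
  obtain D where D: "(c has_derivative D) (at p)"
    using C1 unfolding C1_def by blast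
  have "((\<lambda>x. diag \<xi> *v smooth_switching c \<xi> x) has_derivative (\<lambda>d. diag \<xi> *v W d)) (at x)"
    by (rule bounded_linear.has_derivative[OF _ W]) simp
  then have "((\<lambda>x. (x, diag \<xi> *v smooth_switching c \<xi> x, smooth_switching c \<xi> x)) has_derivative
      (\<lambda>d. (d, diag \<xi> *v W d, W d))) (at x)"
    by (intro has_derivative_Pair has_derivative_ident W)
  then have "((\<lambda>x. c (x, diag \<xi> *v smooth_switching c \<xi> x, smooth_switching c \<xi> x)) has_derivative
      (\<lambda>d. D (d, diag \<xi> *v W d, W d))) (at x)"
    by (rule has_derivative_compose) (use D in \<open>simp add: p_def\<close>)
  then have "(smooth_switching c \<xi> has_derivative (\<lambda>d. D (d, diag \<xi> *v W d, W d))) (at x)"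
    by (simp flip: smooth_switching_fixpoint)
  then have "W = (\<lambda>d. D (d, diag \<xi> *v W d, W d))"
    using W has_derivative_unique by blast
  from fun_cong[OF this, of d] show ?thesis
    unfolding derivative_eq_jacobians[OF D] by (simp only: ac_simps)
qed

text \<open>The right-hand side is again a forward substitution. This yields both the invertibility
  of the matrix in LIKQ and the identification of a directional derivative from the equation it
  solves.\<close>

lemma linearized_switching_unique:
  assumes "w = jac_y c p *v (diag \<xi> *v w) + jac_z c p *v w + q"
    and "w' = jac_y c p *v (diag \<xi> *v w') + jac_z c p *v w' + q"
  shows "w = w'"
proof -
  have "forward (\<lambda>w. jac_y c p *v (diag \<xi> *v w) + jac_z c p *v w + q)"
    unfolding forward_def
  proof (intro allI impI)
    fix z w :: "real ^ 's::{finite,linorder}" and i assume *: "\<forall>j<i. z $ j = w $ j"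
    then have "(jac_y c p *v (diag \<xi> *v z)) $ i = (jac_y c p *v (diag \<xi> *v w)) $ i"
      using strictly_lower_triangular_forward[OF lower_y[of p]] unfolding forward_def by simp
    moreover have "(jac_z c p *v z) $ i = (jac_z c p *v w) $ i"
      using * strictly_lower_triangular_forward[OF lower_z[of p]] unfolding forward_def by blast
    ultimately show "(jac_y c p *v (diag \<xi> *v z) + jac_z c p *v z + q) $ i =
        (jac_y c p *v (diag \<xi> *v w) + jac_z c p *v w + q) $ i"
      by simp
  qed
  then show ?thesis using assms by (rule forward_unique)
qed

section \<open>Signatures, and the kink directions provided by LIKQ\<close>

lemma vabs_eq_diag:
  assumes "\<forall>i. \<sigma> $ i \<in> {-1, 1}" "\<forall>i. 0 \<le> \<sigma> $ i * z $ i"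
  shows "vabs z = diag \<sigma> *v z"
proof -
  have "\<bar>z $ i\<bar> = \<sigma> $ i * z $ i" for i
    using assms(1)[rule_format, of i] assms(2)[rule_format, of i] by auto
  then show ?thesis by (simp add: vec_eq_iff vabs_def)
qed

text \<open>On a vector with signs compatible with \<sigma> both switching equations coincide, so
  uniqueness identifies their solutions. The next lemma is the converse transfer, with the signs
  checked on \<open>switching c x\<close>.\<close>

lemma switching_eq_smooth_switching:
  assumes "\<forall>i. \<sigma> $ i \<in> {-1, 1}" "\<forall>i. 0 \<le> \<sigma> $ i * smooth_switching c \<sigma> x $ i"
  shows "switching c x = smooth_switching c \<sigma> x"
  by (rule switching_eqI) (simp only: vabs_eq_diag[OF assms] flip: smooth_switching_fixpoint)

lemma smooth_switching_eq_switching: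
  assumes "\<forall>i. \<sigma> $ i \<in> {-1, 1}" "\<forall>i. 0 \<le> \<sigma> $ i * switching c x $ i"
  shows "smooth_switching c \<sigma> x = switching c x"
  by (rule smooth_switching_eqI) (simp only: flip: vabs_eq_diag[OF assms] switching_fixpoint)

text \<open>Compatibility becomes a system of weak inequalities, which is preserved under
  limits.\<close>

lemma definite_sigs_iff:
  "\<sigma> \<in> definite_sigs (vsign z) \<longleftrightarrow> (\<forall>i. \<sigma> $ i \<in> {-1, 1}) \<and> (\<forall>i. 0 \<le> \<sigma> $ i * z $ i)"
proof -
  have "\<sigma> $ i * sgn (z $ i) \<ge> (sgn (z $ i))\<^sup>2 \<longleftrightarrow> 0 \<le> \<sigma> $ i * z $ i" if "\<sigma> $ i \<in> {-1, 1}" for i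
    using that by (auto simp: sgn_if)
  then show ?thesis
    unfolding definite_sigs_def sig_succeq_def vsign_def by auto
qed

text \<open>LIKQ concerns the linearization with the kink columns of \<open>L\<close> switched off; switching them
  on with signature \<open>\<sigma>\<close> perturbs the right-hand side only by a vector that depends on the
  prescribed kink components, and full row rank absorbs it.\<close>

lemma LIKQ_direction:
  assumes likq: "LIKQ c x" and \<sigma>: "\<sigma> \<in> definite_sigs (vsign (switching c x))"
    and W: "(smooth_switching c \<sigma> has_derivative W) (at x)"
  obtains d where "\<And>i. switching c x $ i = 0 \<Longrightarrow> W d $ i = \<sigma> $ i"
proof -
  define z where "z = switching c x"
  define p where "p = (x, vabs z, z)"
  define \<sigma>0 where "\<sigma>0 = vsign z"
  define \<alpha> where "\<alpha> = {i. \<sigma>0 $ i = 0}"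
  define B where "B = mat 1 - jac_y c p ** diag \<sigma>0 - jac_z c p"
  define A where "A = matrix_inv B"
  have sigs: "\<forall>i. \<sigma> $ i \<in> {-1, 1}" "\<forall>i. 0 \<le> \<sigma> $ i * z $ i"
    using \<sigma> unfolding definite_sigs_iff z_def by auto
  have B: "B *v w = w - jac_y c p *v (diag \<sigma>0 *v w) - jac_z c p *v w" for w
    by (simp add: B_def matrix_vector_mult_diff_rdistrib matrix_vector_mul_assoc)
  \<comment> \<open>The kernel equation is the linearized switching equation for
    \<open>\<sigma>0\<close> with zero right-hand side, also solved by 0.\<close>
  have "w = 0" if "B *v w = 0" for w
    by (rule linearized_switching_unique[of w p \<sigma>0 0 0]) (use that in \<open>simp_all add: B algebra_simps\<close>)
  then have "inj ((*v) B)"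
    by (subst linear_inj_iff_eq_0) auto
  then have "invertible B"
    by (simp add: matrix_left_invertible_injective invertible_left_inverse)
  then have "B ** A = mat 1"
    unfolding A_def matrix_inv_def invertible_def by (rule someI2_ex) simp
  then have BA: "B *v (A *v q) = q" for q
    by (simp add: matrix_vector_mul_assoc)
  have "rank (row_selector \<alpha> ** (A ** jac_x c p)) = card \<alpha>"
    using likq
    by (simp add: LIKQ_def Let_def \<alpha>_def A_def B_def p_def \<sigma>0_def z_def matrix_mul_assoc)
  \<comment> \<open>The target is obtained by solving \<open>B *v w = jac_y c p *v (diag (\<sigma> -
    \<sigma>0) *v \<sigma>) + jac_x c p *v d\<close> for \<open>w\<close> and requiring
    \<open>w = \<sigma>\<close> on \<alpha>.\<close>
  then obtain d where d: "\<And>i. i \<in> \<alpha> \<Longrightarrow>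
      ((A ** jac_x c p) *v d) $ i = (\<sigma> - A *v (jac_y c p *v (diag (\<sigma> - \<sigma>0) *v \<sigma>))) $ i"
    by (rule row_selector_full_rank_surj[where v = "\<sigma> - A *v (jac_y c p *v (diag (\<sigma> - \<sigma>0) *v \<sigma>))"]) blast
  define w where "w = A *v (jac_y c p *v (diag (\<sigma> - \<sigma>0) *v \<sigma>) + jac_x c p *v d)"
  have w: "w $ i = \<sigma> $ i" if "i \<in> \<alpha>" for i
    using d[OF that] by (simp add: w_def matrix_vector_right_distrib matrix_vector_mul_assoc)
  \<comment> \<open>Off \<alpha> the factor \<open>\<sigma> - \<sigma>0\<close> vanishes, and on
    \<alpha> the vector \<open>w\<close> equals \<sigma>. So \<sigma> may be replaced by
    \<open>w\<close> in the perturbation, which turns the equation for \<sigma>0 into the one for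
    \<sigma>.\<close>
  have "(\<sigma> $ i - \<sigma>0 $ i) * \<sigma> $ i = (\<sigma> $ i - \<sigma>0 $ i) * w $ i" for i
  proof (cases "i \<in> \<alpha>")
    case False
    then have "\<sigma> $ i = \<sigma>0 $ i"
      using sigs(1)[rule_format, of i] sigs(2)[rule_format, of i]
      by (auto simp: \<alpha>_def \<sigma>0_def vsign_def sgn_if split: if_splits)
    then show ?thesis by simp
  qed (simp add: w)
  then have "diag (\<sigma> - \<sigma>0) *v \<sigma> = diag \<sigma> *v w - diag \<sigma>0 *v w"
    by (simp add: vec_eq_iff algebra_simps)
  moreover have "B *v w = jac_y c p *v (diag (\<sigma> - \<sigma>0) *v \<sigma>) + jac_x c p *v d"
    by (simp add: w_def BA)
  ultimately have "w - jac_y c p *v (diag \<sigma>0 *v w) - jac_z c p *v w =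
      jac_y c p *v (diag \<sigma> *v w) - jac_y c p *v (diag \<sigma>0 *v w) + jac_x c p *v d"
    by (simp only: B matrix_vector_mult_diff_distrib)
  then have "w = jac_y c p *v (diag \<sigma> *v w) + jac_z c p *v w + jac_x c p *v d"
    by (simp add: algebra_simps)
  moreover have "p = (x, diag \<sigma> *v smooth_switching c \<sigma> x, smooth_switching c \<sigma> x)"
    using sigs smooth_switching_eq_switching[OF sigs[unfolded z_def]] vabs_eq_diag[OF sigs]
    by (simp add: p_def z_def)
  ultimately have "W d = w"
    using smooth_switching_derivative_fixpoint[OF W, of d] linearized_switching_unique by metis
  then show thesis
    using w by (intro that[of d]) (simp add: \<alpha>_def \<sigma>0_def vsign_def z_def sgn_zero_iff)
qed

end

section \<open>Agreement of the function with its smooth models\<close>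

locale abs_smooth_function = switching_system c
  for c :: "(real ^ 'n) \<times> (real ^ 's::{finite,linorder}) \<times> (real ^ 's::{finite,linorder}) \<Rightarrow> real ^ 's::{finite,linorder}" +
  fixes f :: "(real ^ 'n) \<times> (real ^ 's::{finite,linorder}) \<times> (real ^ 's::{finite,linorder}) \<Rightarrow> real"
    and \<phi> :: "real ^ 'n \<Rightarrow> real"
  assumes C1_f: "C1 f"
    and \<phi>: "\<And>x. \<phi> x = f (x, vabs (switching c x), switching c x)"
begin

lemma eq_smooth_model:
  assumes "\<forall>i. \<sigma> $ i \<in> {-1, 1}" "\<forall>i. 0 \<le> \<sigma> $ i * smooth_switching c \<sigma> x $ i"
  shows "\<phi> x = smooth_model f c \<sigma> x"
  using switching_eq_smooth_switching[OF assms] vabs_eq_diag[OF assms]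
  by (simp add: \<phi> smooth_model_def)

lemma signed_component_derivative:
  assumes "(smooth_switching c \<sigma> has_derivative W) (at x)"
  shows "((\<lambda>x. \<sigma> $ i * smooth_switching c \<sigma> x $ i) has_derivative (\<lambda>d. \<sigma> $ i * W d $ i)) (at x)"
  by (intro has_derivative_mult_right bounded_linear.has_derivative[OF bounded_linear_vec_nth] assms)

lemma eventually_signed:
  assumes W: "(smooth_switching c \<sigma> has_derivative W) (at x)"
    and nonneg: "\<forall>i. 0 \<le> \<sigma> $ i * smooth_switching c \<sigma> x $ i"
    and pos: "\<forall>i. 0 < \<sigma> $ i * smooth_switching c \<sigma> x $ i \<or> 0 < \<sigma> $ i * W e $ i"
  shows "\<forall>\<^sub>F t in at_right 0. \<forall>i. 0 < \<sigma> $ i * smooth_switching c \<sigma> (x + t *\<^sub>R e) $ i"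
proof (rule eventually_all_finite)
  fix i
  show "\<forall>\<^sub>F t in at_right 0. 0 < \<sigma> $ i * smooth_switching c \<sigma> (x + t *\<^sub>R e) $ i"
    using has_derivative_eventually_pos[OF signed_component_derivative[OF W]] nonneg pos by blast
qed

lemma continuous_signed_component:
  "continuous_on UNIV (\<lambda>x. \<sigma> $ i * smooth_switching c \<sigma> x $ i)"
proof -
  obtain D where "\<And>x. (smooth_switching c \<sigma> has_derivative D x) (at x)"
    using C1_smooth_switching unfolding C1_def by blast
  then show ?thesis
    by (intro has_derivative_continuous_on[OF signed_component_derivative])
qed

text \<open>Components away from a kink already have the strict sign; at a kink the direction gives
  \<open>\<sigma> $ i * W d $ i = 1\<close>, because the entries of \<sigma> are 1 or -1.\<close>

lemma LIKQ_sign_direction: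
  assumes "LIKQ c x" "\<sigma> \<in> definite_sigs (vsign (switching c x))"
    and "(smooth_switching c \<sigma> has_derivative W) (at x)"
  obtains d where "\<forall>i. 0 < \<sigma> $ i * smooth_switching c \<sigma> x $ i \<or> 0 < \<sigma> $ i * W d $ i"
proof -
  obtain d where d: "\<And>i. switching c x $ i = 0 \<Longrightarrow> W d $ i = \<sigma> $ i"
    by (rule LIKQ_direction[OF assms]) blast
  have sigs: "\<forall>i. \<sigma> $ i \<in> {-1, 1}" "\<forall>i. 0 \<le> \<sigma> $ i * switching c x $ i"
    using assms(2) unfolding definite_sigs_iff by auto
  have "0 < \<sigma> $ i * switching c x $ i \<or> 0 < \<sigma> $ i * W d $ i" for i
  proof (cases "switching c x $ i = 0")
    case True
    with d sigs(1)[rule_format, of i] show ?thesis by auto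
  next
    case False
    with sigs(1)[rule_format, of i] sigs(2)[rule_format, of i] show ?thesis
      by (auto simp: less_le)
  qed
  then show thesis
    using smooth_switching_eq_switching[OF sigs] by (intro that[of d]) simp
qed

section \<open>Gradients of compatible models are limiting gradients\<close>

lemma gradient_smooth_model_in_limiting_gradients:
  assumes likq: "LIKQ c x" and \<sigma>: "\<sigma> \<in> definite_sigs (vsign (switching c x))"
  shows "gradient (smooth_model f c \<sigma>) x \<in> limiting_gradients \<phi> x"
proof -
  obtain W where W: "(smooth_switching c \<sigma> has_derivative W) (at x)"
    using C1_smooth_switching unfolding C1_def by blast
  obtain d where d: "\<forall>i. 0 < \<sigma> $ i * smooth_switching c \<sigma> x $ i \<or> 0 < \<sigma> $ i * W d $ i"
    by (rule LIKQ_sign_direction[OF likq \<sigma> W])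
  have sigs: "\<forall>i. \<sigma> $ i \<in> {-1, 1}" "\<forall>i. 0 \<le> \<sigma> $ i * switching c x $ i"
    using \<sigma> unfolding definite_sigs_iff by auto
  have "\<forall>i. 0 \<le> \<sigma> $ i * smooth_switching c \<sigma> x $ i"
    using sigs smooth_switching_eq_switching by simp
  from eventually_signed[OF W this d] obtain r where r: "r > 0"
    and pos: "\<And>t i. 0 < t \<Longrightarrow> t < r \<Longrightarrow> 0 < \<sigma> $ i * smooth_switching c \<sigma> (x + t *\<^sub>R d) $ i"
    unfolding eventually_at_right_field by auto
  \<comment> \<open>On the open set \<open>V\<close> all signs are strict, so \<phi> coincides with
    the model there and inherits its derivative.\<close>
  define V where "V = (\<Inter>i. {y. 0 < \<sigma> $ i * smooth_switching c \<sigma> y $ i})"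
  have "open V"
    unfolding V_def
    by (intro open_INT ballI open_Collect_less continuous_on_const continuous_signed_component) simp
  obtain D where D: "\<And>x. (smooth_model f c \<sigma> has_derivative D x) (at x)"
    using C1_smooth_model[OF C1_f] unfolding C1_def by blast
  have \<phi>_D: "(\<phi> has_derivative D y) (at y)" if "y \<in> V" for y
  proof (rule has_derivative_transform_within_open[OF D \<open>open V\<close> that])
    fix v assume "v \<in> V"
    then have "\<forall>i. 0 \<le> \<sigma> $ i * smooth_switching c \<sigma> v $ i"
      by (auto simp: V_def less_imp_le)
    with sigs show "smooth_model f c \<sigma> v = \<phi> v" using eq_smooth_model by simp
  qed
  \<comment> \<open>The denominator \<open>real k + 2\<close> keeps the step strictly between 0 and
    \<open>r\<close> already for \<open>k = 0\<close>.\<close>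
  define X where "X k = x + (r / (real k + 2)) *\<^sub>R d" for k
  have X: "X k \<in> V" for k
  proof -
    have "0 < r / (real k + 2)" "r / (real k + 2) < r"
      using r by (simp_all add: field_simps add_pos_nonneg)
    then show ?thesis
      using pos by (simp add: X_def V_def)
  qed
  have "(\<lambda>k. r / (real k + 2)) \<longlonglongrightarrow> 0"
    by real_asymp
  then have "X \<longlonglongrightarrow> x + 0 *\<^sub>R d"
    unfolding X_def[abs_def] by (intro tendsto_intros)
  then have lim: "X \<longlonglongrightarrow> x" by simp
  have "gradient \<phi> (X k) = gradient (smooth_model f c \<sigma>) (X k)" for k
    using gradient_eq_sum_Basis[OF \<phi>_D[OF X]] gradient_eq_sum_Basis[OF D] by simp
  moreover have "isCont (gradient (smooth_model f c \<sigma>)) x"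
    using C1_continuous_gradient[OF C1_smooth_model[OF C1_f]] by (simp add: continuous_on_eq_continuous_at)
  ultimately have "(\<lambda>k. gradient \<phi> (X k)) \<longlonglongrightarrow> gradient (smooth_model f c \<sigma>) x"
    using isCont_tendsto_compose lim by simp
  moreover have "\<phi> differentiable at (X k)" for k
    using \<phi>_D[OF X] by (rule differentiableI)
  ultimately show ?thesis
    using lim unfolding limiting_gradients_def by blast
qed

section \<open>Limiting gradients are gradients of compatible models\<close>

text \<open>Differentiability at a kink does not matter: \<open>\<phi>\<close> agrees with \<open>smooth_model f c \<sigma>\<close> along an
  open set of directions, which already determines the gradient.\<close>

lemma gradient_eq_smooth_model:
  assumes diff: "\<phi> differentiable at x"
    and definite: "\<forall>i. \<sigma> $ i \<in> {-1, 1}"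
    and W: "(smooth_switching c \<sigma> has_derivative W) (at x)"
    and nonneg: "\<forall>i. 0 \<le> \<sigma> $ i * smooth_switching c \<sigma> x $ i"
    and pos: "\<forall>i. 0 < \<sigma> $ i * smooth_switching c \<sigma> x $ i \<or> 0 < \<sigma> $ i * W d $ i"
  shows "gradient \<phi> x = gradient (smooth_model f c \<sigma>) x"
proof -
  obtain D where D: "(smooth_model f c \<sigma> has_derivative D) (at x)"
    using C1_smooth_model[OF C1_f] unfolding C1_def by blast
  obtain D' where D': "(\<phi> has_derivative D') (at x)"
    using diff unfolding differentiable_def by blast
  \<comment> \<open>All directions that open up the signs as \<open>d\<close> does. The set is open
    because the linear map \<open>W\<close> is continuous.\<close>
  define U where "U = (\<Inter>i. {e. 0 < \<sigma> $ i * smooth_switching c \<sigma> x $ i \<or> 0 < \<sigma> $ i * W e $ i})"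
  have "continuous_on UNIV W"
    using W has_derivative_bounded_linear linear_continuous_on by blast
  then have "open U"
    unfolding U_def
    by (intro open_INT ballI open_Collect_disj open_Collect_less continuous_intros) simp
  have "D' = D"
  proof (rule has_derivative_eqI_directions[OF D' D \<open>open U\<close>])
    show "d \<in> U" using pos by (simp add: U_def)
    show "\<phi> x = smooth_model f c \<sigma> x" using eq_smooth_model[OF definite nonneg] .
    fix e assume "e \<in> U"
    then have "\<forall>\<^sub>F t in at_right 0. \<forall>i. 0 < \<sigma> $ i * smooth_switching c \<sigma> (x + t *\<^sub>R e) $ i"
      by (intro eventually_signed[OF W nonneg]) (simp add: U_def)
    then show "\<forall>\<^sub>F t in at_right 0. \<phi> (x + t *\<^sub>R e) = smooth_model f c \<sigma> (x + t *\<^sub>R e)"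
      by eventually_elim (intro eq_smooth_model[OF definite], simp add: less_imp_le)
  qed
  then show ?thesis
    using gradient_eq_sum_Basis[OF D] gradient_eq_sum_Basis[OF D'] by simp
qed

text \<open>Pigeonhole over the finitely many definite signatures. A zero component counts as
  positive, which is harmless since only weak sign compatibility is asked for.\<close>

lemma subsequence_constant_signature:
  obtains \<sigma> and r :: "nat \<Rightarrow> nat"
  where "strict_mono r" "\<forall>i. \<sigma> $ i \<in> {-1, 1}"
    and "\<And>k. \<forall>i. 0 \<le> \<sigma> $ i * smooth_switching c \<sigma> (X (r k)) $ i"
proof -
  define sig :: "'s set \<Rightarrow> real ^ 's::{finite,linorder}" where "sig S = (\<chi> i. if i \<in> S then 1 else - 1)" for S
  define \<tau> where "\<tau> k = sig {i. 0 \<le> switching c (X k) $ i}" for k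
  have "finite (range \<tau>)"
    by (rule finite_subset[of _ "range sig"]) (auto simp: \<tau>_def)
  then obtain k0 where "infinite {k. \<tau> k = \<tau> k0}"
    using pigeonhole_infinite[of UNIV \<tau>] by auto
  then obtain r :: "nat \<Rightarrow> nat" where r: "strict_mono r" "\<And>k. \<tau> (r k) = \<tau> k0"
    using infinite_enumerate by blast
  have definite: "\<forall>i. \<tau> k $ i \<in> {-1, 1}" for k
    by (simp add: \<tau>_def sig_def)
  have "\<forall>i. 0 \<le> \<tau> k $ i * switching c (X k) $ i" for k
    by (simp add: \<tau>_def sig_def)
  then have "\<forall>i. 0 \<le> \<tau> k $ i * smooth_switching c (\<tau> k) (X k) $ i" for k
    using smooth_switching_eq_switching[OF definite] by simp
  from this[of "r _"] have "\<forall>i. 0 \<le> \<tau> k0 $ i * smooth_switching c (\<tau> k0) (X (r k)) $ i" for k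
    unfolding r(2) .
  with r(1) definite show thesis by (rule that)
qed

lemma limiting_gradient_eq_smooth_model:
  assumes likq: "LIKQ c x" and g: "g \<in> limiting_gradients \<phi> x"
  obtains \<sigma> where "\<sigma> \<in> definite_sigs (vsign (switching c x))"
    and "g = gradient (smooth_model f c \<sigma>) x"
proof -
  obtain X where X: "X \<longlonglongrightarrow> x" "\<And>k. \<phi> differentiable at (X k)"
    "(\<lambda>k. gradient \<phi> (X k)) \<longlonglongrightarrow> g"
    using g unfolding limiting_gradients_def by blast
  obtain \<sigma> and r :: "nat \<Rightarrow> nat" where r: "strict_mono r"
    and definite: "\<forall>i. \<sigma> $ i \<in> {-1, 1}"
    and nonneg: "\<And>k. \<forall>i. 0 \<le> \<sigma> $ i * smooth_switching c \<sigma> (X (r k)) $ i"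
    by (rule subsequence_constant_signature[of X]) blast
  have Xr: "(\<lambda>k. X (r k)) \<longlonglongrightarrow> x"
    using LIMSEQ_subseq_LIMSEQ[OF X(1) r] by (simp add: o_def)
  have comp: "(\<lambda>k. \<sigma> $ i * smooth_switching c \<sigma> (X (r k)) $ i) \<longlonglongrightarrow>
      \<sigma> $ i * smooth_switching c \<sigma> x $ i" for i
    using continuous_on_tendsto_compose[OF continuous_signed_component Xr] by simp
  have nonneg_x: "\<forall>i. 0 \<le> \<sigma> $ i * smooth_switching c \<sigma> x $ i"
  proof
    fix i
    show "0 \<le> \<sigma> $ i * smooth_switching c \<sigma> x $ i"
      by (rule LIMSEQ_le_const[OF comp]) (use nonneg in blast)
  qed
  \<comment> \<open>The limit of the weak inequalities makes \<sigma> compatible at \<open>x\<close>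
    itself, so that LIKQ at \<open>x\<close> can supply a direction for it.\<close>
  have \<sigma>: "\<sigma> \<in> definite_sigs (vsign (switching c x))"
    unfolding definite_sigs_iff switching_eq_smooth_switching[OF definite nonneg_x]
    using definite nonneg_x by blast
  obtain D where D: "\<And>y. (smooth_switching c \<sigma> has_derivative D y) (at y)"
      "\<And>v. continuous_on UNIV (\<lambda>y. D y v)"
    using C1_smooth_switching unfolding C1_def by blast
  obtain d where d: "\<forall>i. 0 < \<sigma> $ i * smooth_switching c \<sigma> x $ i \<or> 0 < \<sigma> $ i * D x d $ i"
    by (rule LIKQ_sign_direction[OF likq \<sigma> D(1)])
  have Dd: "(\<lambda>k. \<sigma> $ i * D (X (r k)) d $ i) \<longlonglongrightarrow> \<sigma> $ i * D x d $ i" for i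
    using continuous_on_tendsto_compose[OF D(2) Xr] by (auto intro!: tendsto_intros)
  \<comment> \<open>Whichever alternative is strict at \<open>x\<close> stays strict at late points
    of the sequence, so the single direction \<open>d\<close> serves all of them.\<close>
  have "\<forall>\<^sub>F k in sequentially. \<forall>i. 0 < \<sigma> $ i * smooth_switching c \<sigma> (X (r k)) $ i \<or>
      0 < \<sigma> $ i * D (X (r k)) d $ i"
  proof (rule eventually_all_finite)
    fix i
    from d consider "0 < \<sigma> $ i * smooth_switching c \<sigma> x $ i" | "0 < \<sigma> $ i * D x d $ i"
      by blast
    then show "\<forall>\<^sub>F k in sequentially. 0 < \<sigma> $ i * smooth_switching c \<sigma> (X (r k)) $ i \<or>
        0 < \<sigma> $ i * D (X (r k)) d $ i"
    proof cases
      case 1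
      from order_tendstoD(1)[OF comp 1] show ?thesis by eventually_elim blast
    next
      case 2
      from order_tendstoD(1)[OF Dd 2] show ?thesis by eventually_elim blast
    qed
  qed
  then have "\<forall>\<^sub>F k in sequentially. gradient \<phi> (X (r k)) = gradient (smooth_model f c \<sigma>) (X (r k))"
    by eventually_elim (rule gradient_eq_smooth_model[OF X(2) definite D(1) nonneg])
  moreover have "(\<lambda>k. gradient \<phi> (X (r k))) \<longlonglongrightarrow> g"
    using LIMSEQ_subseq_LIMSEQ[OF X(3) r] by (simp add: o_def)
  ultimately have "(\<lambda>k. gradient (smooth_model f c \<sigma>) (X (r k))) \<longlonglongrightarrow> g"
    by (rule Lim_transform_eventually[rotated])
  moreover have "(\<lambda>k. gradient (smooth_model f c \<sigma>) (X (r k))) \<longlonglongrightarrow> gradient (smooth_model f c \<sigma>) x"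
    using continuous_on_tendsto_compose[OF C1_continuous_gradient[OF C1_smooth_model[OF C1_f]] Xr]
    by simp
  ultimately have "g = gradient (smooth_model f c \<sigma>) x"
    by (rule LIMSEQ_unique)
  with \<sigma> show thesis by (rule that)
qed

end

theorem corollary7:
  fixes f :: "(real ^ 'n) \<times> (real ^ 's::{finite,linorder}) \<times> (real ^ 's::{finite,linorder}) \<Rightarrow> real"
    and c :: "(real ^ 'n) \<times> (real ^ 's::{finite,linorder}) \<times> (real ^ 's::{finite,linorder}) \<Rightarrow> real ^ 's::{finite,linorder}"
    and \<phi> :: "real ^ 'n \<Rightarrow> real"
    and x0 :: "real ^ 'n"
  assumes "evaluation_procedure f c \<phi>"
    and "LIKQ c x0"
  shows "limiting_gradients \<phi> x0 =
    (\<Union>\<sigma> \<in> definite_sigs (vsign (switching c x0)). {gradient (smooth_model f c \<sigma>) x0})"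
proof -
  interpret abs_smooth_function c f \<phi>
    using assms(1) unfolding evaluation_procedure_def
    by unfold_locales (auto intro: C2_imp_C1)
  show ?thesis
    using gradient_smooth_model_in_limiting_gradients[OF assms(2)]
      limiting_gradient_eq_smooth_model[OF assms(2)]
    by blast
qed

end
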